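(* Let $M_1$ be a loopless matroid on ground set $E$ with $\beta(M_1)\le 2$, let $k$ be a positive integer, and let $M_2$ be a matroid on $E$ with no $(k+1)$-spanned elements. (a) If $M_1$ has property (P), then $\beta(M_1\cap M_2)\le k+1$. (b) If $M_1$ has property (R), then $\beta(M_1\cap M_2)\le k+2$.
   Context: An element $e$ of a matroid is $(k+1)$-spanned if there exist $k+1$ pairwise disjoint subsets of the ground set each of which spans $e$ (i.e. $e$ lies in the closure of each). $\beta(M)$ is the minimum number of independent sets covering the ground set; $\beta(M_1\cap M_2)$ is the minimum number of common independent sets of $M_1,M_2$ covering $E$. For a matroid with circuit set $\mathcal{C}$ and $X\subseteq E$, $\mathcal{C}[X]$ is the set of circuits contained in $X$. A graph on matroid elements covers a family of circuits if every circuit of the family contains both endpoints of some edge; graphs may have parallel edges. Property (P): for any bases $A,B$ there is a path with vertex set $A\triangle B$ covering $\mathcal{C}[A\cup B]$. Property (R): for any bases $A,B$ there is a 2-regular graph with vertex set $A\triangle B$ covering $\mathcal{C}[A\cup B]$. *)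

theory Defs
  imports Main "HOL-Library.Multiset" "HOL-Library.Extended_Nat"
begin

locale matroid =
  fixes E :: "'a set" and I :: "'a set set"
  assumes finite_ground: "finite E"
    and indep_subset_ground: "X \<in> I \<Longrightarrow> X \<subseteq> E"
    and indep_empty: "{} \<in> I"
    and indep_subset: "X \<in> I \<Longrightarrow> Y \<subseteq> X \<Longrightarrow> Y \<in> I"
    and indep_augment: "X \<in> I \<Longrightarrow> Y \<in> I \<Longrightarrow> card X < card Y \<Longrightarrow> \<exists>y\<in>Y - X. insert y X \<in> I"

definition matroid_basis :: "'a set set \<Rightarrow> 'a set \<Rightarrow> bool" where
  "matroid_basis I B \<longleftrightarrow> B \<in> I \<and> (\<forall>X\<in>I. B \<subseteq> X \<longrightarrow> X = B)"

definition circuit :: "'a set \<Rightarrow> 'a set set \<Rightarrow> 'a set \<Rightarrow> bool" where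
  "circuit E I C \<longleftrightarrow> C \<subseteq> E \<and> C \<notin> I \<and> (\<forall>X. X \<subset> C \<longrightarrow> X \<in> I)"

definition circuits_in :: "'a set \<Rightarrow> 'a set set \<Rightarrow> 'a set \<Rightarrow> 'a set set" where
  "circuits_in E I X = {C. circuit E I C \<and> C \<subseteq> X}"

definition loopless :: "'a set \<Rightarrow> 'a set set \<Rightarrow> bool" where
  "loopless E I \<longleftrightarrow> (\<forall>e\<in>E. \<not> circuit E I {e})"

definition matroid_rank :: "'a set set \<Rightarrow> 'a set \<Rightarrow> nat" where
  "matroid_rank I X = Max {card Y | Y. Y \<in> I \<and> Y \<subseteq> X}"

definition matroid_closure :: "'a set \<Rightarrow> 'a set set \<Rightarrow> 'a set \<Rightarrow> 'a set" where
  "matroid_closure E I X = {e \<in> E. matroid_rank I (insert e X) = matroid_rank I X}"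

text \<open>The \<open>n\<close> spanning sets form an indexed family, so that the empty set may be repeated;
  hence a loop is \<open>n\<close>-spanned for every \<open>n\<close>.\<close>

definition spanned :: "nat \<Rightarrow> 'a set \<Rightarrow> 'a set set \<Rightarrow> 'a \<Rightarrow> bool" where
  "spanned n E I e \<longleftrightarrow>
     (\<exists>S. (\<forall>i<n. S i \<subseteq> E \<and> e \<in> matroid_closure E I (S i)) \<and>
          (\<forall>i<n. \<forall>j<n. i \<noteq> j \<longrightarrow> S i \<inter> S j = {}))"

text \<open>The value is \<open>\<infinity>\<close> if \<open>E\<close> cannot be covered by members of \<open>I\<close>.\<close>

definition covering_number :: "'a set \<Rightarrow> 'a set set \<Rightarrow> enat" where
  "covering_number E I = (INF F \<in> {F. finite F \<and> F \<subseteq> I \<and> E \<subseteq> \<Union>F}. enat (card F))"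

text \<open>A graph is given by its vertex set and the multiset of its edges, each edge being the set of
  its two endpoints: parallel edges are possible, edges joining a vertex to itself are not.\<close>

definition multigraph :: "'a set \<Rightarrow> 'a set multiset \<Rightarrow> bool" where
  "multigraph V G \<longleftrightarrow> finite V \<and> (\<forall>e\<in>#G. e \<subseteq> V \<and> card e = 2)"

definition graph_degree :: "'a set multiset \<Rightarrow> 'a \<Rightarrow> nat" where
  "graph_degree G v = size {#e \<in># G. v \<in> e#}"

definition two_regular_graph :: "'a set \<Rightarrow> 'a set multiset \<Rightarrow> bool" where
  "two_regular_graph V G \<longleftrightarrow> multigraph V G \<and> (\<forall>v\<in>V. graph_degree G v = 2)"

text \<open>The path without vertices is admitted; it is needed for \<open>A = B\<close> in property (P).\<close>

definition path_graph :: "'a set \<Rightarrow> 'a set multiset \<Rightarrow> bool" where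
  "path_graph V G \<longleftrightarrow>
     (\<exists>vs. distinct vs \<and> set vs = V \<and>
           G = mset (map (\<lambda>i. {vs ! i, vs ! Suc i}) [0..<length vs - 1]))"

definition covers :: "'a set multiset \<Rightarrow> 'a set set \<Rightarrow> bool" where
  "covers G \<C> \<longleftrightarrow> (\<forall>C\<in>\<C>. \<exists>e\<in>#G. e \<subseteq> C)"

definition property_P :: "'a set \<Rightarrow> 'a set set \<Rightarrow> bool" where
  "property_P E I \<longleftrightarrow>
     (\<forall>A B. matroid_basis I A \<longrightarrow> matroid_basis I B \<longrightarrow>
        (\<exists>G. path_graph (sym_diff A B) G \<and> covers G (circuits_in E I (A \<union> B))))"

definition property_R :: "'a set \<Rightarrow> 'a set set \<Rightarrow> bool" where
  "property_R E I \<longleftrightarrow>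
     (\<forall>A B. matroid_basis I A \<longrightarrow> matroid_basis I B \<longrightarrow>
        (\<exists>G. two_regular_graph (sym_diff A B) G \<and> covers G (circuits_in E I (A \<union> B))))"

end

theory Submission
  imports Defs
begin

text \<open>Extend two independent sets covering \<open>E\<close> to bases \<open>A\<close>, \<open>B\<close> of \<open>M\<^sub>1\<close>. The graph given by (P) or (R)
  covers every circuit of \<open>M\<^sub>1\<close>, so its stable sets are independent in \<open>M\<^sub>1\<close>, and it remains to
  partition \<open>E\<close> into stable sets independent in \<open>M\<^sub>2\<close>. This is done greedily: given disjoint colour
  classes independent in \<open>M\<^sub>2\<close>, a new element \<open>e\<close> is spanned by fewer than \<open>k\<close> of them, because \<open>{e}\<close>
  itself is one further set spanning \<open>e\<close>. Hence \<open>k + d\<close> colours suffice as soon as \<open>e\<close> has at most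
  \<open>d\<close> coloured neighbours, where \<open>d = 1\<close> along a path and \<open>d = 2\<close> in a 2-regular graph.\<close>

section \<open>Degeneracy of paths and of 2-regular graphs\<close>

definition neighbours_in :: "'a set multiset \<Rightarrow> 'a set \<Rightarrow> 'a \<Rightarrow> 'a set" where
  "neighbours_in G S v = {u \<in> S - {v}. {u, v} \<in># G}"

definition stable_set :: "'a set multiset \<Rightarrow> 'a set \<Rightarrow> bool" where
  "stable_set G X \<longleftrightarrow> (\<forall>e\<in>#G. \<not> e \<subseteq> X)"

text \<open>This is \<open>d\<close>-degeneracy of the subgraph induced on \<open>V\<close>.
  \<open>V\<close> is not tied to the vertex set of \<open>G\<close>, because the whole ground set
  has to be coloured and elements outside the graph count as isolated vertices.\<close>

definition degenerate :: "nat \<Rightarrow> 'a set multiset \<Rightarrow> 'a set \<Rightarrow> bool" where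
  "degenerate d G V \<longleftrightarrow> (\<forall>S\<subseteq>V. S \<noteq> {} \<longrightarrow> (\<exists>v\<in>S. card (neighbours_in G S v) \<le> d))"

lemma degenerate_subset: "degenerate d G V \<Longrightarrow> W \<subseteq> V \<Longrightarrow> degenerate d G W"
  by (simp add: degenerate_def)

text \<open>Each neighbour determines its own edge at \<open>v\<close>. Equality may fail because
  parallel edges give one neighbour but count separately in the degree.\<close>

lemma card_neighbours_in_le_graph_degree: "card (neighbours_in G S v) \<le> graph_degree G v"
proof -
  have "inj_on (\<lambda>u. {u, v}) (neighbours_in G S v)"
    by (auto simp: inj_on_def neighbours_in_def doubleton_eq_iff)
  moreover have "(\<lambda>u. {u, v}) ` neighbours_in G S v \<subseteq> set_mset {#e \<in># G. v \<in> e#}"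
    by (auto simp: neighbours_in_def)
  ultimately have "card (neighbours_in G S v) \<le> card (set_mset {#e \<in># G. v \<in> e#})"
    by (meson card_inj_on_le finite_set_mset)
  also have "\<dots> \<le> size {#e \<in># G. v \<in> e#}"
    using size_mset_mono[OF mset_set_set_mset_msubset] by (metis size_mset_set)
  finally show ?thesis
    by (simp add: graph_degree_def)
qed

lemma two_regular_graph_degenerate:
  assumes "two_regular_graph V G"
  shows "degenerate 2 G W"
proof -
  have "graph_degree G v \<le> 2" for v
  \<comment> \<open>\<open>W\<close> is arbitrary, so vertices outside the graph occur as well; they
    have degree 0.\<close>
  proof (cases "v \<in> V")
    case False
    then have "{#e \<in># G. v \<in> e#} = {#}"
      using assms by (auto simp: two_regular_graph_def multigraph_def)
    then show ?thesis
      unfolding graph_degree_def by (metis size_empty zero_le)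
  qed (use assms in \<open>simp add: two_regular_graph_def\<close>)
  then have "card (neighbours_in G S v) \<le> 2" for S v
    by (rule order_trans[OF card_neighbours_in_le_graph_degree])
  then show ?thesis
    by (auto simp: degenerate_def)
qed

text \<open>In a set of path vertices, take the one that comes first along the path: its predecessor
  lies outside the set, so only its successor can be a neighbour.\<close>

lemma path_graph_degenerate:
  assumes "path_graph V G"
  shows "degenerate 1 G W"
proof -
  obtain vs where vs: "distinct vs" "set vs = V"
    and G: "G = mset (map (\<lambda>i. {vs ! i, vs ! Suc i}) [0..<length vs - 1])"
    using assms by (auto simp: path_graph_def)
  have edge: "\<exists>j. Suc j < length vs \<and> e = {vs ! j, vs ! Suc j}" if "e \<in># G" for e
  proof -
    obtain j where "j < length vs - 1" "e = {vs ! j, vs ! Suc j}"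
      using \<open>e \<in># G\<close> by (auto simp: G)
    moreover from this have "Suc j < length vs"
      by linarith
    ultimately show ?thesis
      by blast
  qed
  have "\<exists>v\<in>S. card (neighbours_in G S v) \<le> 1" if "S \<noteq> {}" for S
  proof (cases "S \<subseteq> V")
    case False
    then obtain v where v: "v \<in> S" "v \<notin> V"
      by blast
    have "v \<notin> e" if "e \<in># G" for e
      using edge[OF that] v vs by (auto dest: Suc_lessD)
    then have "neighbours_in G S v = {}"
      by (fastforce simp: neighbours_in_def)
    then show ?thesis
      using v by (metis card.empty zero_le)
  next
    case True
    define P where "P i \<longleftrightarrow> i < length vs \<and> vs ! i \<in> S" for i
    define i where "i = (LEAST i. P i)"
    obtain s where "s \<in> S"
      using \<open>S \<noteq> {}\<close> by blast
    then have "\<exists>i. P i"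
      using True vs(2) unfolding P_def by (metis in_set_conv_nth subsetD)
    then have i: "P i" and least: "\<And>j. P j \<Longrightarrow> i \<le> j"
      unfolding i_def by (auto intro: LeastI Least_le)
    have "u = vs ! Suc i" if "u \<in> neighbours_in G S (vs ! i)" for u
    proof -
      have u: "u \<in> S" "u \<noteq> vs ! i" "{u, vs ! i} \<in># G"
        using that by (auto simp: neighbours_in_def)
      then obtain j where j: "Suc j < length vs" "{u, vs ! i} = {vs ! j, vs ! Suc j}"
        using edge by blast
      then consider "u = vs ! j" "vs ! i = vs ! Suc j" | "u = vs ! Suc j" "vs ! i = vs ! j"
        by (auto simp: doubleton_eq_iff)
      then show ?thesis
      proof cases
        case 1
        then have "i = Suc j" "P j"
          using i j u vs(1) by (auto simp: P_def nth_eq_iff_index_eq)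
        then show ?thesis
          using least by fastforce
      next
        case 2
        then show ?thesis
          using i j vs(1) by (auto simp: P_def nth_eq_iff_index_eq)
      qed
    qed
    \<comment> \<open>If \<open>i\<close> is the last index, \<open>vs ! Suc i\<close> is out of
      range; the inclusion still holds, as there are then no neighbours.\<close>
    then have "neighbours_in G S (vs ! i) \<subseteq> {vs ! Suc i}"
      by blast
    then have "card (neighbours_in G S (vs ! i)) \<le> 1"
      using card_mono[of "{vs ! Suc i}"] by simp
    then show ?thesis
      using i by (auto simp: P_def)
  qed
  then show ?thesis
    unfolding degenerate_def by blast
qed

lemma path_graph_edge_card:
  assumes "path_graph V G" "e \<in># G"
  shows "card e = 2"
proof -
  obtain vs i where "distinct vs" "i < length vs - 1" "e = {vs ! i, vs ! Suc i}"
    using assms by (auto simp: path_graph_def)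
  moreover from this have "vs ! i \<noteq> vs ! Suc i"
    by (subst nth_eq_iff_index_eq) auto
  ultimately show ?thesis
    by simp
qed

section \<open>Spanning and greedy colouring in a single matroid\<close>

context matroid
begin

lemma indep_extends_to_basis:
  assumes "X \<in> I"
  obtains B where "matroid_basis I B" "X \<subseteq> B"
proof -
  have "finite I"
    using finite_ground indep_subset_ground by (meson PowI finite_Pow_iff finite_subset subsetI)
  then obtain B where "B \<in> I" "X \<subseteq> B" "\<forall>Y\<in>I. B \<subseteq> Y \<longrightarrow> Y = B"
    using finite_has_maximal2[OF _ assms] by (metis (no_types))
  then show thesis
    using that by (auto simp: matroid_basis_def)
qed

lemma dependent_contains_circuit:
  assumes "X \<subseteq> E" "X \<notin> I"
  obtains C where "circuit E I C" "C \<subseteq> X"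
proof -
  have "finite {Y. Y \<subseteq> X \<and> Y \<notin> I}"
    using assms finite_ground by (simp add: finite_subset)
  then obtain C where "C \<subseteq> X" "C \<notin> I" "\<forall>Y. Y \<subseteq> X \<and> Y \<notin> I \<longrightarrow> Y \<subseteq> C \<longrightarrow> C = Y"
    using finite_has_minimal2[of "{Y. Y \<subseteq> X \<and> Y \<notin> I}" X] assms by auto
  then have "circuit E I C"
    using assms(1) unfolding circuit_def by blast
  then show thesis
    using that \<open>C \<subseteq> X\<close> by blast
qed

text \<open>An independent subset of \<open>insert e X\<close> larger than \<open>X\<close> would
  augment \<open>X\<close>, necessarily by \<open>e\<close>. Hence \<open>X\<close> and
  \<open>insert e X\<close> both have rank \<open>card X\<close>.\<close>

lemma closure_if_dependent_insert:
  assumes "X \<in> I" "e \<in> E" "insert e X \<notin> I"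
  shows "e \<in> matroid_closure E I X"
proof -
  have bound: "card Y \<le> card X" if "Y \<in> I" "Y \<subseteq> insert e X" for Y
    using indep_augment[OF \<open>X \<in> I\<close> \<open>Y \<in> I\<close>] that assms(3) by (metis Diff_iff insert_iff not_less subsetD)
  have "matroid_rank I Z = card X" if "X \<subseteq> Z" "Z \<subseteq> insert e X" for Z
    unfolding matroid_rank_def
  proof (rule Max_eqI)
    have "{card Y |Y. Y \<in> I \<and> Y \<subseteq> Z} \<subseteq> {..card X}"
      using bound that by auto
    then show "finite {card Y |Y. Y \<in> I \<and> Y \<subseteq> Z}"
      using finite_subset by blast
  qed (use assms(1) bound that in blast)+
  then have "matroid_rank I (insert e X) = card X" "matroid_rank I X = card X"
    by blast+
  then show ?thesis
    using assms(2) by (simp add: matroid_closure_def)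
qed

lemma card_spanning_classes_less:
  assumes "e \<in> E" "\<not> spanned (k + 1) E I e"
    and indep: "\<And>i. i < n \<Longrightarrow> X i \<in> I" and "\<And>i. i < n \<Longrightarrow> e \<notin> X i"
    and disj: "\<And>i j. i < n \<Longrightarrow> j < n \<Longrightarrow> i \<noteq> j \<Longrightarrow> X i \<inter> X j = {}"
  shows "card {i \<in> {..<n}. insert e (X i) \<notin> I} < k"
proof (rule ccontr)
  define J where "J = {i \<in> {..<n}. insert e (X i) \<notin> I}"
  assume "\<not> ?thesis"
  then have "card {..<k} \<le> card J"
    by (simp add: J_def)
  then obtain g where g: "g ` {..<k} \<subseteq> J" "inj_on g {..<k}"
    using card_le_inj[of "{..<k}" J] by (fastforce simp: J_def)
  \<comment> \<open>The injection \<open>g\<close> selects \<open>k\<close> distinct classes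
    spanning \<open>e\<close>. Among the indices below \<open>k + 1\<close> only \<open>k\<close>
    itself yields \<open>{e}\<close>, which is disjoint from the classes since none contains
    \<open>e\<close>.\<close>
  define S where "S i = (if i < k then X (g i) else {e})" for i
  have gJ: "g i < n" "insert e (X (g i)) \<notin> I" if "i < k" for i
    using g(1) that by (auto simp: J_def)
  have "S i \<subseteq> E \<and> e \<in> matroid_closure E I (S i)" for i
  proof (cases "i < k")
    case True
    then show ?thesis
      using closure_if_dependent_insert[OF indep assms(1)] gJ indep_subset_ground[OF indep]
      by (simp add: S_def)
  next
    case False
    then show ?thesis
      using assms(1) by (simp add: S_def matroid_closure_def)
  qed
  moreover have "S i \<inter> S j = {}" if "i < k + 1" "j < k + 1" "i \<noteq> j" for i j
  proof (cases "i < k \<and> j < k")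
    case True
    then have "g i \<noteq> g j"
      using g(2) that by (auto dest: inj_onD)
    then show ?thesis
      using True disj gJ by (simp add: S_def)
  next
    case False
    then show ?thesis
      using that assms(4) gJ by (auto simp: S_def)
  qed
  ultimately have "spanned (k + 1) E I e"
    unfolding spanned_def by blast
  with assms(2) show False ..
qed

text \<open>Induction on the size of \<open>S\<close>: delete a vertex with at most \<open>d\<close>
  neighbours, colour the rest, then colour that vertex. Classes of colours that do not occur are
  empty, so the claim can range over all \<open>i\<close>.\<close>

lemma greedy_colouring:
  assumes "\<forall>e\<in>E. \<not> spanned (k + 1) E I e"
    and edges: "\<forall>e\<in>#G. card e = 2"
    and "degenerate d G S" "S \<subseteq> E"
  shows "\<exists>c. \<forall>i. {v \<in> S. c v = i} \<in> I \<and> stable_set G {v \<in> S. c v = i} \<and> c ` S \<subseteq> {..<k + d}"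
  using assms(3,4)
proof (induction "card S" arbitrary: S)
  case 0
  then have "S = {}"
    using finite_ground finite_subset by fastforce
  moreover have "stable_set G {}"
    using edges by (auto simp: stable_set_def)
  ultimately show ?case
    using indep_empty by simp
next
  case (Suc m)
  then have "S \<noteq> {}"
    by auto
  then obtain e where e: "e \<in> S" "card (neighbours_in G S e) \<le> d"
    using Suc.prems(1) unfolding degenerate_def by blast
  define T where "T = S - {e}"
  have "finite S"
    using Suc.prems finite_ground finite_subset by blast
  have "m = card T" "degenerate d G T" "T \<subseteq> E"
    using Suc e degenerate_subset[of d G S T] by (auto simp: T_def)
  from Suc.hyps(1)[OF this] obtain c where
    c: "\<And>i. {v \<in> T. c v = i} \<in> I" "\<And>i. stable_set G {v \<in> T. c v = i}" "c ` T \<subseteq> {..<k + d}"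
    by blast
  define X where "X i = {v \<in> T. c v = i}" for i
  define J where "J = {i \<in> {..<k + d}. insert e (X i) \<notin> I}"
  have "card J < k"
    unfolding J_def
    by (rule card_spanning_classes_less) (use c assms(1) e Suc.prems in \<open>auto simp: X_def T_def\<close>)
  moreover have "card (c ` neighbours_in G S e) \<le> d"
    using e(2) card_image_le[of "neighbours_in G S e" c] \<open>finite S\<close>
    by (simp add: neighbours_in_def)
  \<comment> \<open>\<open>J\<close> holds the colours forbidden by the matroid, fewer than
    \<open>k\<close>; the neighbours forbid at most \<open>d\<close> more. The strict inequality
    leaves a free colour.\<close>
  ultimately have "card (J \<union> c ` neighbours_in G S e) < card {..<k + d}"
    using card_Un_le[of J "c ` neighbours_in G S e"] by simp
  then have "\<not> {..<k + d} \<subseteq> J \<union> c ` neighbours_in G S e"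
    using \<open>finite S\<close> card_mono[of "J \<union> c ` neighbours_in G S e" "{..<k + d}"]
    by (auto simp: J_def neighbours_in_def)
  then obtain a where a: "a < k + d" "a \<notin> J" "a \<notin> c ` neighbours_in G S e"
    by blast
  have X_new: "{v \<in> S. (c(e := a)) v = i} = (if i = a then insert e (X i) else X i)" for i
    using e(1) by (auto simp: X_def T_def)
  have "stable_set G (insert e (X a))"
    unfolding stable_set_def
  proof (intro ballI notI)
    fix f
    assume f: "f \<in># G" "f \<subseteq> insert e (X a)"
    \<comment> \<open>The old class contains no edge, so \<open>f\<close> must join \<open>e\<close>
      to a neighbour of colour \<open>a\<close>, contrary to the choice of \<open>a\<close>.\<close>
    have "\<not> f \<subseteq> X a"
      using c(2)[of a] f by (auto simp: stable_set_def X_def)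
    then have "e \<in> f"
      using f by blast
    then obtain u where u: "f = {u, e}" "u \<noteq> e"
      using edges f(1) by (fastforce simp: card_2_iff)
    then have "u \<in> neighbours_in G S e" "c u = a"
      using f by (auto simp: neighbours_in_def X_def T_def)
    then show False
      using a(3) by blast
  qed
  moreover have "insert e (X a) \<in> I"
    using a by (auto simp: J_def)
  moreover have "X i \<in> I" "stable_set G (X i)" for i
    using c(1,2) by (simp_all add: X_def)
  ultimately have "{v \<in> S. (c(e := a)) v = i} \<in> I \<and> stable_set G {v \<in> S. (c(e := a)) v = i}" for i
    unfolding X_new by simp
  moreover have "(c(e := a)) ` S \<subseteq> {..<k + d}"
    using c(3) a(1) by (auto simp: T_def)
  ultimately show ?case
    by blast
qed

end

section \<open>From covering numbers to colourings and back\<close>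

lemma covering_number_leI:
  assumes "finite F" "F \<subseteq> I" "E \<subseteq> \<Union>F" "card F \<le> n"
  shows "covering_number E I \<le> enat n"
  unfolding covering_number_def by (rule INF_lower2[of F]) (use assms in simp_all)

lemma covering_number_leE:
  assumes "covering_number E I \<le> enat n"
  obtains F where "finite F" "F \<subseteq> I" "E \<subseteq> \<Union>F" "card F \<le> n"
proof -
  \<comment> \<open>A strict upper bound on an infimum is witnessed by a member of the family, so
    the bound is first made strict.\<close>
  have "covering_number E I < enat (Suc n)"
    by (rule le_less_trans[OF assms]) simp
  then obtain F where "finite F" "F \<subseteq> I" "E \<subseteq> \<Union>F" "card F < Suc n"
    by (auto simp: covering_number_def INF_less_iff)
  then show thesis
    using that by simp
qed

lemma (in matroid) covered_by_two_bases:
  assumes "covering_number E I \<le> 2"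
  obtains A B where "matroid_basis I A" "matroid_basis I B" "A \<union> B = E"
proof -
  obtain F where F: "finite F" "F \<subseteq> I" "E \<subseteq> \<Union>F" "card F \<le> 2"
    using assms covering_number_leE[of E I 2] by (auto simp: numeral_eq_enat)
  have "\<exists>X\<in>I. \<exists>Y\<in>I. E \<subseteq> X \<union> Y"
  proof -
    \<comment> \<open>A cover by fewer than two sets is padded, by repeating its only member or by
      using the empty set.\<close>
    consider "card F = 0" | "card F = 1" | "card F = 2"
      using F(4) by linarith
    then show ?thesis
    proof cases
      case 1
      then show ?thesis
        using F indep_empty by auto
    next
      case 2
      then obtain X where "F = {X}"
        by (auto simp: card_1_singleton_iff)
      then show ?thesis
        using F by auto
    next
      case 3
      then obtain X Y where "F = {X, Y}"
        by (auto simp: card_2_iff)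
      then show ?thesis
        using F by auto
    qed
  qed
  then obtain X Y where XY: "X \<in> I" "Y \<in> I" "E \<subseteq> X \<union> Y"
    by blast
  obtain A where A: "matroid_basis I A" "X \<subseteq> A"
    using indep_extends_to_basis XY(1) by blast
  obtain B where B: "matroid_basis I B" "Y \<subseteq> B"
    using indep_extends_to_basis XY(2) by blast
  have "A \<subseteq> E" "B \<subseteq> E"
    using A(1) B(1) indep_subset_ground by (simp_all add: matroid_basis_def)
  then have "A \<union> B = E"
    using A(2) B(2) XY(3) by blast
  then show thesis
    using that A B by blast
qed

text \<open>A colour class dependent in the first matroid would contain a circuit, hence an edge
  covering that circuit, and so would not be stable. Properties (P) and (R) enter only through the
  value of \<open>d\<close>.\<close>

lemma covering_number_inter_le:
  assumes "matroid E I1" "matroid E I2"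
    and "\<forall>e\<in>E. \<not> spanned (k + 1) E I2 e"
    and "\<forall>e\<in>#G. card e = 2" "degenerate d G E" "covers G (circuits_in E I1 E)"
  shows "covering_number E (I1 \<inter> I2) \<le> enat (k + d)"
proof -
  obtain c where c: "\<And>i. {v \<in> E. c v = i} \<in> I2" "\<And>i. stable_set G {v \<in> E. c v = i}"
    "c ` E \<subseteq> {..<k + d}"
    using matroid.greedy_colouring[OF assms(2-5)] by blast
  have "{v \<in> E. c v = i} \<in> I1" for i
  proof (rule ccontr)
    assume "{v \<in> E. c v = i} \<notin> I1"
    then obtain C where "circuit E I1 C" "C \<subseteq> {v \<in> E. c v = i}"
      using matroid.dependent_contains_circuit[OF assms(1), of "{v \<in> E. c v = i}"] by blast
    then have "C \<in> circuits_in E I1 E"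
      by (auto simp: circuits_in_def)
    then obtain f where "f \<in># G" "f \<subseteq> C"
      using assms(6) by (auto simp: covers_def)
    then show False
      using c(2)[of i] \<open>C \<subseteq> _\<close> unfolding stable_set_def by blast
  qed
  then show ?thesis
    using c card_image_le[of "{..<k + d}" "\<lambda>i. {v \<in> E. c v = i}"]
    by (intro covering_number_leI[of "(\<lambda>i. {v \<in> E. c v = i}) ` {..<k + d}"]) auto
qed

theorem theorem21:
  fixes E :: "'a set" and I1 I2 :: "'a set set" and k :: nat
  assumes "matroid E I1"
    and "loopless E I1"
    and "covering_number E I1 \<le> 2"
    and "k > 0"
    and "matroid E I2"
    and "\<forall>e\<in>E. \<not> spanned (k + 1) E I2 e"
  shows "(property_P E I1 \<longrightarrow> covering_number E (I1 \<inter> I2) \<le> enat (k + 1)) \<and>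
         (property_R E I1 \<longrightarrow> covering_number E (I1 \<inter> I2) \<le> enat (k + 2))"
proof -
  \<comment> \<open>Since \<open>A \<union> B = E\<close>, a graph on \<open>sym_diff A B\<close>
    supplied by either property covers every circuit of the first matroid.\<close>
  obtain A B where AB: "matroid_basis I1 A" "matroid_basis I1 B" "A \<union> B = E"
    using matroid.covered_by_two_bases[OF assms(1,3)] .
  note bound = covering_number_inter_le[OF assms(1,5,6)]
  show ?thesis
  proof (intro conjI impI)
    assume "property_P E I1"
    then obtain G where G: "path_graph (sym_diff A B) G" "covers G (circuits_in E I1 E)"
      using AB unfolding property_P_def by metis
    show "covering_number E (I1 \<inter> I2) \<le> enat (k + 1)"
      using path_graph_edge_card[OF G(1)] by (intro bound[OF _ path_graph_degenerate[OF G(1)] G(2)]) simp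
  next
    assume "property_R E I1"
    then obtain G where G: "two_regular_graph (sym_diff A B) G" "covers G (circuits_in E I1 E)"
      using AB unfolding property_R_def by metis
    then have "\<forall>e\<in>#G. card e = 2"
      by (simp add: two_regular_graph_def multigraph_def)
    then show "covering_number E (I1 \<inter> I2) \<le> enat (k + 2)"
      by (rule bound[OF _ two_regular_graph_degenerate[OF G(1)] G(2)])
  qed
qed

end
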